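(* For every finite simple graph $H$ with no isolated vertex, $$\gamma(H)\le |V(H)|-\nu(H),$$ where $\nu(H)$ is the number of connected components of $H$. Moreover, equality holds if and only if $H$ is a disjoint union of stars.
   Context: For a finite simple graph $H$, $\gamma(H)=\frac12\left(|V(H)|+\delta(H)\right)$, where $\delta(H)=\max\{|S|-|N_H(S)|: S\subset V(H)\}$ (the empty set $S$ is allowed) and $N_H(S)$ is the set of all vertices of $H$ adjacent to at least one vertex of $S$. A star is a graph $K_{1,s}$ with $s\ge1$ (a single edge is a star). *)

theory Defs
  imports Complex_Main "Graph_Theory.Kuratowski"
begin

(* Finite simple graphs are the library's locale predicate graph: finite, loop-free,
   symmetric digraphs without multiple arcs, so each edge is a pair of opposite arcs. *)

definition neighbours :: "('a, 'b) pre_digraph \<Rightarrow> 'a set \<Rightarrow> 'a set" where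
  "neighbours H S = {v \<in> verts H. \<exists>u\<in>S. u \<rightarrow>\<^bsub>H\<^esub> v}"

definition graph_delta :: "('a, 'b) pre_digraph \<Rightarrow> int" where
  "graph_delta H = Max {int (card S) - int (card (neighbours H S)) | S. S \<subseteq> verts H}"

definition graph_gamma :: "('a, 'b) pre_digraph \<Rightarrow> real" where
  "graph_gamma H = (real (card (verts H)) + of_int (graph_delta H)) / 2"

(* The subgraphs considered by max_subgraph need not be symmetric and connected ignores the
   directions of arcs, but a maximal connected subgraph is always an induced one. *)
definition components :: "('a, 'b) pre_digraph \<Rightarrow> ('a, 'b) pre_digraph set" where
  "components H = {C. pre_digraph.max_subgraph H connected C}"

definition star :: "('a, 'b) pre_digraph \<Rightarrow> bool" where
  "star K \<longleftrightarrow> (\<exists>s\<ge>1. K\<^bsub>1,s\<^esub> K)"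

(* The empty family is allowed; its union is the graph without vertices. *)
definition disjoint_union_of_stars :: "('a, 'b) pre_digraph \<Rightarrow> bool" where
  "disjoint_union_of_stars H \<longleftrightarrow>
     (\<exists>F. (\<forall>K\<in>F. subgraph K H \<and> star K) \<and>
          pairwise (\<lambda>K L. verts K \<inter> verts L = {}) F \<and>
          H = pre_digraph.Union H F)"

end

theory Submission
  imports Defs
begin

text \<open>
  Multiplying out, the inequality says that \<open>|V - S| + |N(S)| \<ge> 2\<nu>\<close> for every vertex set \<open>S\<close>, and
  equality in it says that some \<open>S\<close> attains \<open>2\<nu>\<close>. This total is a sum over the components \<open>C\<close>
  (\<open>total_eq_sum_contributions\<close>), so the question is local: a component contributes
  \<open>|C - S| + |N(S) \<inter> C|\<close>. Since there are no isolated vertices, a component has at least two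
  vertices, and \<open>N(S)\<close> contains \<open>C\<close> as soon as \<open>S\<close> does; hence the contribution is at least
  \<open>|C| \<ge> 2\<close> if \<open>S\<close> misses \<open>C\<close> or contains it, and at least
  \<open>1 + 1\<close> otherwise (\<open>contribution_ge_2\<close>).

  A contribution of exactly 2 forces \<open>C\<close> to be a star: either \<open>|C| = 2\<close>, or \<open>C - S\<close> and
  \<open>N(S) \<inter> C\<close> are singletons, and these must coincide, so that every other vertex of \<open>C\<close> sees only
  this one (\<open>contribution_eq_2_centre\<close>). Conversely, in a disjoint union of stars the set \<open>S\<close> of all
  leaves leaves out only the centres and has only centres as neighbours, so its total is
  \<open>2\<nu>\<close> (\<open>disjoint_union_of_stars_total_le\<close>).
\<close>

section \<open>Components of a graph\<close>

lemma strongly_connected_imp_connected: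
  assumes "strongly_connected C"
  shows "connected C"
  unfolding connected_conv
proof (intro conjI ballI)
  show "verts C \<noteq> {}"
    using assms by (simp add: strongly_connected_def)
  fix u v
  assume "u \<in> verts C" "v \<in> verts C"
  then have "(u, v) \<in> rtrancl_on (verts C) (arcs_ends C)"
    using assms by (auto simp: strongly_connected_def reachable_def)
  then show "(u, v) \<in> rtrancl_on (verts C) ((arcs_ends C)\<^sup>s)"
    by (rule rtrancl_on_mono[rotated 2]) (auto simp: symcl_def)
qed

lemma arc_mono_connected: "arc_mono connected"
  unfolding arc_mono_def
  by (metis spanning_def subgraphE wf_digraph.connected_spanning_imp_connected)

text \<open>
  Although weak connectedness is weaker than strong connectedness and the subgraphs compared in
  the maximality condition need not be symmetric, the induced subgraph on the same vertices is
  symmetric, and there the two notions of connectedness agree. This makes the theory of strongly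
  connected components available.
\<close>

lemma (in sym_digraph) components_eq_sccs: "components G = sccs"
proof (intro set_eqI iffI)
  fix C
  assume "C \<in> components G"
  then have max: "max_subgraph connected C"
    by (simp add: components_def)
  then have "induced_subgraph C G"
    using arc_mono_connected by (rule induced_subgraphI_arc_mono)
  then interpret C: sym_digraph C
    by (rule induced_graph_imp_graph)
  have "strongly_connected C"
    using C.sym_arcs max_subgraph_prop[OF max] by (rule C.symmetric_connected_imp_strongly_connected)
  then have "max_subgraph strongly_connected C"
    by (intro max_subgraph_mp[OF max] strongly_connected_imp_connected)
  then show "C \<in> sccs"
    by (simp add: sccs_altdef2)
next
  fix C
  assume C: "C \<in> sccs"
  then have ind: "induced_subgraph C G"
    by (rule in_sccs_imp_induced)
  have "max_subgraph connected C"
  proof (rule max_subgraphI)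
    show "connected C"
      using C by (blast intro: strongly_connected_imp_connected)
    show "subgraph C G"
      using ind by (rule induced_imp_subgraph)
    fix D
    assume D: "C \<noteq> D" "subgraph C D" "subgraph D G"
    show "\<not> connected D"
    proof
      assume "connected D"
      let ?D = "G \<restriction> verts D"
      have indD: "induced_subgraph ?D G"
        using D(3) by (intro induced_induce) blast
      interpret D: sym_digraph ?D
        using indD by (rule induced_graph_imp_graph)
      have "connected ?D"
        using subgraph_induce_subgraphI2[OF D(3)] \<open>connected D\<close>
        by (intro D.connected_spanning_imp_connected[of D]) (auto simp: spanning_def)
      then have "strongly_connected ?D"
        using D.sym_arcs by (intro D.symmetric_connected_imp_strongly_connected)
      with indD C have "\<not> verts C \<subset> verts ?D"
        by blast
      then have eq: "verts D = verts C"
        using D(2) by auto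
      then have "arcs D \<subseteq> arcs C"
        using ind D(3) by (auto simp: induced_subgraph_altdef)
      with eq D(2) have "C = D"
        by (intro pre_digraph.equality) (auto simp: subgraph_def compatible_def)
      with D(1) show False ..
    qed
  qed
  then show "C \<in> components G"
    by (simp add: components_def)
qed

lemma (in sym_digraph) card_components: "card (components G) = card sccs_verts"
proof -
  have "inj_on verts sccs"
    by (rule inj_onI) (metis in_sccsE induce_eq_iff_induced)
  then show ?thesis
    by (simp add: components_eq_sccs sccs_verts_conv card_image)
qed

lemma (in wf_digraph) Union_sccs_verts: "\<Union>sccs_verts = verts G"
  using in_scc_of_self scc_of_in_sccs_verts sccs_verts_subsets by blast

lemma (in fin_digraph) card_eq_sum_sccs_verts:
  assumes "A \<subseteq> verts G"
  shows "card A = (\<Sum>C\<in>sccs_verts. card (A \<inter> C))"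
proof -
  have "card (\<Union>C\<in>sccs_verts. A \<inter> C) = (\<Sum>C\<in>sccs_verts. card (A \<inter> C))"
  proof (rule card_UN_disjoint[OF finite_sccs_verts])
    show "\<forall>C\<in>sccs_verts. finite (A \<inter> C)"
      using finite_subset[OF assms finite_verts] by blast
    show "\<forall>C\<in>sccs_verts. \<forall>D\<in>sccs_verts. C \<noteq> D \<longrightarrow> A \<inter> C \<inter> (A \<inter> D) = {}"
      using sccs_verts_disjoint by blast
  qed
  moreover have "(\<Union>C\<in>sccs_verts. A \<inter> C) = A"
    using assms Union_sccs_verts by blast
  ultimately show ?thesis
    by (simp only:)
qed

lemma (in sym_digraph) sccs_verts_closed:
  assumes "C \<in> sccs_verts" "u \<in> C" "u \<rightarrow> v"
  shows "v \<in> C"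
  using assms symmetric_reachable'[of u v]
  by (auto simp: in_sccs_verts_conv_reachable)

text \<open>
  Reachability cannot leave a set that no arc leaves, so such a set is maximal as soon as it
  is connected.
\<close>

lemma (in sym_digraph) in_sccs_vertsI_closed:
  assumes "C \<noteq> {}"
    and conn: "\<And>u v. u \<in> C \<Longrightarrow> v \<in> C \<Longrightarrow> u \<rightarrow>\<^sup>* v"
    and closed: "\<And>u v. u \<in> C \<Longrightarrow> u \<rightarrow> v \<Longrightarrow> v \<in> C"
  shows "C \<in> sccs_verts"
proof -
  have "v \<in> C" if "u \<rightarrow>\<^sup>* v" "u \<in> C" for u v
    using that by (induct rule: reachable_induct) (auto intro: closed)
  with assms(1) conn show ?thesis
    unfolding in_sccs_verts_conv_reachable by blast
qed

section \<open>The contribution of one component\<close>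

lemma (in wf_digraph) neighbours_iff: "v \<in> neighbours G S \<longleftrightarrow> (\<exists>u\<in>S. u \<rightarrow> v)"
  by (auto simp: neighbours_def adj_in_verts)

locale no_isolated_graph = graph +
  assumes no_isolated: "v \<in> verts G \<Longrightarrow> \<exists>u. v \<rightarrow> u"
begin

lemma obtain_neighbour:
  assumes "C \<in> sccs_verts" "v \<in> C"
  obtains u where "u \<in> C" "u \<noteq> v" "v \<rightarrow> u" "u \<rightarrow> v"
proof -
  from assms obtain u where "v \<rightarrow> u"
    using no_isolated sccs_verts_subsets by blast
  with assms that show ?thesis
    using sccs_verts_closed adj_not_same graph_symmetric by metis
qed

lemma finite_component:
  assumes "C \<in> sccs_verts"
  shows "finite C"
  using assms sccs_verts_subsets finite_verts finite_subset by blast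

lemma component_nonempty:
  assumes "C \<in> sccs_verts"
  shows "C \<noteq> {}"
  using assms by (simp add: in_sccs_verts_conv_reachable)

lemma card_component_ge_2:
  assumes "C \<in> sccs_verts"
  shows "2 \<le> card C"
proof -
  obtain v where v: "v \<in> C"
    using component_nonempty[OF assms] by blast
  then obtain u where "u \<in> C" "u \<noteq> v"
    by (rule obtain_neighbour[OF assms])
  with v have "card {u, v} \<le> card C"
    by (intro card_mono finite_component[OF assms]) auto
  with \<open>u \<noteq> v\<close> show ?thesis
    by simp
qed

lemma component_subset_neighbours:
  assumes "C \<in> sccs_verts" "C \<subseteq> S"
  shows "C \<subseteq> neighbours G S"
  unfolding subset_iff neighbours_iff using assms obtain_neighbour by (metis subsetD)

lemma component_meets_neighbours:
  assumes "C \<in> sccs_verts" "S \<inter> C \<noteq> {}"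
  shows "neighbours G S \<inter> C \<noteq> {}"
proof -
  from assms(2) obtain v where v: "v \<in> S" "v \<in> C"
    by blast
  from assms(1) v(2) obtain u where "u \<in> C" "v \<rightarrow> u"
    by (rule obtain_neighbour)
  with v have "u \<in> neighbours G S \<inter> C"
    unfolding Int_iff neighbours_iff by blast
  then show ?thesis
    by blast
qed

text \<open>
  If \<open>S\<close> misses or contains \<open>C\<close>, then one of the two summands alone is \<open>|C|\<close>; otherwise both
  are positive, because a vertex of \<open>S\<close> in \<open>C\<close> has a neighbour, and this lies in \<open>C\<close> again.
\<close>

lemma component_cases:
  assumes "C \<in> sccs_verts"
  obtains (trivial) "card C \<le> card (C - S) + card (neighbours G S \<inter> C)"
  | (proper) "0 < card (C - S)" "0 < card (neighbours G S \<inter> C)"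
proof -
  note fin = finite_component[OF assms]
  consider "S \<inter> C = {}" | "C \<subseteq> S" | "S \<inter> C \<noteq> {}" "C - S \<noteq> {}"
    by blast
  then show thesis
  proof cases
    case 1
    then have "C - S = C"
      by blast
    then show thesis
      using trivial by simp
  next
    case 2
    then have "neighbours G S \<inter> C = C"
      using component_subset_neighbours[OF assms] by blast
    then show thesis
      using trivial by simp
  next
    case 3
    then show thesis
      using fin component_meets_neighbours[OF assms] by (intro proper) (auto simp: card_gt_0_iff)
  qed
qed

lemma contribution_ge_2:
  assumes "C \<in> sccs_verts"
  shows "2 \<le> card (C - S) + card (neighbours G S \<inter> C)"
  using card_component_ge_2[OF assms] by (cases rule: component_cases[OF assms, of S]) linarith+

text \<open>
  A contribution of 2 leaves two possibilities. If \<open>|C| = 2\<close>, either vertex can be the centre \<open>w\<close>.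
  Otherwise both summands are 1, and the one vertex of \<open>C\<close> outside \<open>S\<close> is also the only neighbour
  that the others can have.
\<close>

lemma contribution_eq_2_centre:
  assumes C: "C \<in> sccs_verts"
    and eq: "card (C - S) + card (neighbours G S \<inter> C) = 2"
  obtains w where "w \<in> C" "\<forall>v\<in>C - {w}. \<forall>u. v \<rightarrow> u \<longrightarrow> u = w"
proof (cases rule: component_cases[OF C, of S])
  case 1
  with eq card_component_ge_2[OF C] have "card C = 2"
    by linarith
  then obtain a b where ab: "C = {a, b}"
    by (auto simp: card_2_iff)
  have "u = a" if "v \<in> C - {a}" "v \<rightarrow> u" for v u
    using that ab sccs_verts_closed[OF C, of v u] adj_not_same by auto
  with that ab show thesis
    by blast
next
  case 2
  with eq have "card (C - S) = 1" "card (neighbours G S \<inter> C) = 1"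
    by linarith+
  then obtain w x where w: "C - S = {w}" and x: "neighbours G S \<inter> C = {x}"
    by (auto simp: card_1_singleton_iff)
  have only_x: "u = x" if "v \<in> S" "v \<in> C" "v \<rightarrow> u" for v u
    using that x sccs_verts_closed[OF C, of v u] neighbours_iff[of u S] by blast
  \<comment> \<open>If \<open>x\<close> belonged to \<open>S\<close>, then its own neighbours would all equal \<open>x\<close>, giving a loop.\<close>
  have "x \<notin> S"
  proof
    assume "x \<in> S"
    have "x \<in> C"
      using x by blast
    with C obtain y where "y \<noteq> x" "x \<rightarrow> y"
      by (rule obtain_neighbour)
    with only_x[OF \<open>x \<in> S\<close> \<open>x \<in> C\<close>] show False
      by blast
  qed
  with w x have "x = w"
    by blast
  with w only_x have "u = w" if "v \<in> C - {w}" "v \<rightarrow> u" for v u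
    using that by blast
  with that w show thesis
    by blast
qed

lemma star_induce_component:
  assumes C: "C \<in> sccs_verts" and w: "w \<in> C"
    and centre: "\<forall>v\<in>C - {w}. \<forall>u. v \<rightarrow> u \<longrightarrow> u = w"
  shows "star (G \<restriction> C)"
proof -
  let ?K = "G \<restriction> C"
  let ?L = "C - {w}"
  have ind: "induced_subgraph ?K G"
    by (rule induced_induce[OF sccs_verts_subsets[OF C]])
  have "graph ?K"
    using digraphI_induced[OF ind] induced_graph_imp_symmetric[OF sym_arcs ind]
    by (rule digraph.graphI)
  have adj: "u \<rightarrow>\<^bsub>?K\<^esub> v \<longleftrightarrow> u \<in> C \<and> v \<in> C \<and> u \<rightarrow> v" for u v
    by (auto simp: arcs_ends_conv)
  have leaf: "v \<rightarrow> w \<and> w \<rightarrow> v" if v: "v \<in> ?L" for v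
  proof -
    obtain u where u: "v \<rightarrow> u" "u \<rightarrow> v"
      using v by (elim DiffE) (rule obtain_neighbour[OF C])
    moreover from centre v u(1) have "u = w"
      by simp
    ultimately show ?thesis
      by simp
  qed
  have centre_arc: "u = w \<and> v \<in> ?L \<or> u \<in> ?L \<and> v = w" if "u \<in> C" "v \<in> C" "u \<rightarrow> v" for u v
  proof (cases "u = w")
    case True
    with that adj_not_same show ?thesis
      by auto
  next
    case False
    with that centre show ?thesis
      by auto
  qed
  have ends: "arcs_ends ?K = {w} \<times> ?L \<union> ?L \<times> {w}"
  proof (intro equalityI subrelI)
    fix u v
    assume "u \<rightarrow>\<^bsub>?K\<^esub> v"
    with centre_arc show "(u, v) \<in> {w} \<times> ?L \<union> ?L \<times> {w}"
      unfolding adj by auto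
  next
    fix u v
    assume "(u, v) \<in> {w} \<times> ?L \<union> ?L \<times> {w}"
    with leaf w show "u \<rightarrow>\<^bsub>?K\<^esub> v"
      unfolding adj by auto
  qed
  have "verts ?K = {w} \<union> ?L" "{w} \<inter> ?L = {}"
    using w by auto
  with \<open>graph ?K\<close> ends have "K\<^bsub>1,card ?L\<^esub> ?K"
    unfolding complete_bipartite_digraph_def
    by (metis is_singletonI is_singleton_altdef)
  moreover have "1 \<le> card ?L"
    using card_component_ge_2[OF C] w finite_component[OF C] by simp
  ultimately show ?thesis
    unfolding star_def by blast
qed

section \<open>Summing over the components\<close>

lemma total_eq_sum_contributions:
  "card (verts G - S) + card (neighbours G S)
    = (\<Sum>C\<in>sccs_verts. card (C - S) + card (neighbours G S \<inter> C))"
proof -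
  have "(verts G - S) \<inter> C = C - S" if "C \<in> sccs_verts" for C
    using sccs_verts_subsets[OF that] by blast
  then show ?thesis
    using card_eq_sum_sccs_verts[of "verts G - S"] card_eq_sum_sccs_verts[of "neighbours G S"]
    by (simp add: sum.distrib neighbours_def)
qed

lemma total_ge:
  "2 * card sccs_verts \<le> card (verts G - S) + card (neighbours G S)"
  using sum_mono[of sccs_verts "\<lambda>_. 2", OF contribution_ge_2]
  by (simp add: total_eq_sum_contributions mult.commute)

lemma disjoint_union_of_stars_if_total_eq:
  assumes "card (verts G - S) + card (neighbours G S) = 2 * card sccs_verts"
  shows "disjoint_union_of_stars G"
proof -
  have eq: "(\<Sum>C\<in>sccs_verts. 2) = (\<Sum>C\<in>sccs_verts. card (C - S) + card (neighbours G S \<inter> C))"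
    using assms by (simp add: total_eq_sum_contributions)
  have "star K" if "K \<in> sccs" for K
  proof -
    from that obtain C where C: "C \<in> sccs_verts" and K: "K = G \<restriction> C"
      by (auto simp: sccs_conv_sccs_verts)
    \<comment> \<open>All terms are at least 2 and they add up to \<open>2\<nu>\<close>, so none of them exceeds 2.\<close>
    have "card (C - S) + card (neighbours G S \<inter> C) = 2"
      using sum_mono_inv[OF eq contribution_ge_2 C finite_sccs_verts] by simp
    with C obtain w where "w \<in> C" "\<forall>v\<in>C - {w}. \<forall>u. v \<rightarrow> u \<longrightarrow> u = w"
      by (rule contribution_eq_2_centre)
    with C show ?thesis
      unfolding K by (intro star_induce_component)
  qed
  then show ?thesis
    unfolding disjoint_union_of_stars_def
    using graph_is_union_sccs scc_disj in_sccs_imp_induced induced_imp_subgraph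
    by (intro exI[of _ sccs]) (auto simp: pairwise_def)
qed

text \<open>
  The witness is the set of all leaves: its complement and its neighbourhood both consist of
  centres only. The stars are components, so their number is at most \<open>\<nu>\<close>.
\<close>

lemma disjoint_union_of_stars_total_le:
  assumes "disjoint_union_of_stars G"
  obtains S where "S \<subseteq> verts G" "card (verts G - S) + card (neighbours G S) \<le> 2 * card sccs_verts"
proof -
  from assms obtain F where sub: "\<And>K. K \<in> F \<Longrightarrow> subgraph K G"
    and st: "\<And>K. K \<in> F \<Longrightarrow> star K"
    and disj: "\<And>K K'. K \<in> F \<Longrightarrow> K' \<in> F \<Longrightarrow> K \<noteq> K' \<Longrightarrow> verts K \<inter> verts K' = {}"
    and un: "G = Union F"
    unfolding disjoint_union_of_stars_def pairwise_def by metis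
  have "\<exists>c L. verts K = insert c L \<and> arcs_ends K = {c} \<times> L \<union> L \<times> {c}" if "K \<in> F" for K
    using st[OF that] unfolding star_def complete_bipartite_digraph_def
    by (auto simp: card_1_singleton_iff)
  then obtain c L where cL: "\<And>K. K \<in> F \<Longrightarrow> verts K = insert (c K) (L K)"
      "\<And>K. K \<in> F \<Longrightarrow> arcs_ends K = {c K} \<times> L K \<union> L K \<times> {c K}"
    by metis
  have verts_G: "verts G = (\<Union>K\<in>F. verts K)" and arcs_G: "arcs G = (\<Union>K\<in>F. arcs K)"
    by (subst un, simp add: Union_def)+
  \<comment> \<open>An arc of \<open>G\<close> comes from some star, and disjointness makes it the one containing its tail.\<close>
  have arc_in_star: "u \<rightarrow>\<^bsub>K\<^esub> v" if "K \<in> F" "u \<in> verts K" "u \<rightarrow> v" for K u v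
  proof -
    from that(3) obtain e where e: "e \<in> arcs G" "tail G e = u" "head G e = v"
      by blast
    with arcs_G obtain K' where K': "K' \<in> F" "e \<in> arcs K'"
      by blast
    interpret K': wf_digraph K'
      using sub[OF K'(1)] by blast
    have "u \<rightarrow>\<^bsub>K'\<^esub> v"
      using sub[OF K'(1)] K'(2) e by (auto simp: arcs_ends_conv subgraph_def compatible_def)
    moreover from this have "K' = K"
      using K'(1) that disj K'.adj_in_verts(1) by blast
    ultimately show ?thesis
      by simp
  qed
  have comp: "verts K \<in> sccs_verts" if K: "K \<in> F" for K
  proof (rule in_sccs_vertsI_closed)
    show "verts K \<noteq> {}"
      using cL(1)[OF K] by simp
  next
    fix u v
    assume uv: "u \<in> verts K" "v \<in> verts K"
    have "u \<rightarrow>\<^sup>* c K \<and> c K \<rightarrow>\<^sup>* u" if "u \<in> verts K" for u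
    proof (cases "u = c K")
      case True
      then show ?thesis
        using that K verts_G by auto
    next
      case False
      with that cL[OF K] have "u \<rightarrow>\<^bsub>K\<^esub> c K" "c K \<rightarrow>\<^bsub>K\<^esub> u"
        by auto
      then show ?thesis
        using adj_mono[OF _ sub[OF K]] by blast
    qed
    with uv show "u \<rightarrow>\<^sup>* v"
      by (blast intro: reachable_trans)
  next
    fix u v
    assume "u \<in> verts K" "u \<rightarrow> v"
    then show "v \<in> verts K"
      using arc_in_star[OF K] cL[OF K] by blast
  qed
  have inj: "inj_on verts F"
    using disj cL(1) by (intro inj_onI) blast
  have verts_F: "verts ` F \<subseteq> sccs_verts"
    using comp by blast
  have finF: "finite F"
    by (rule finite_imageD[OF finite_subset[OF verts_F finite_sccs_verts] inj])
  have cardF: "card F \<le> card sccs_verts"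
    by (rule card_inj_on_le[OF inj verts_F finite_sccs_verts])
  let ?S = "\<Union>K\<in>F. L K"
  have "verts G - ?S \<subseteq> c ` F"
    unfolding verts_G using cL(1) by auto
  then have "card (verts G - ?S) \<le> card F"
    by (rule surj_card_le[OF finF])
  moreover have "neighbours G ?S \<subseteq> c ` F"
  proof
    fix v
    assume "v \<in> neighbours G ?S"
    then obtain u K where K: "K \<in> F" "u \<in> L K" "u \<rightarrow> v"
      unfolding neighbours_iff by (elim bexE UN_E)
    have "u \<rightarrow>\<^bsub>K\<^esub> v"
      using K(1) _ K(3) by (rule arc_in_star) (simp add: cL(1) K)
    moreover have "c K \<notin> L K"
    proof
      assume "c K \<in> L K"
      then have "c K \<rightarrow>\<^bsub>K\<^esub> c K"
        by (simp add: cL(2)[OF K(1)])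
      then show False
        using adj_mono[OF _ sub[OF K(1)]] adj_not_same by metis
    qed
    ultimately have "v = c K"
      using K(2) by (auto simp: cL(2)[OF K(1)])
    with K(1) show "v \<in> c ` F"
      by simp
  qed
  then have "card (neighbours G ?S) \<le> card F"
    by (rule surj_card_le[OF finF])
  ultimately have "card (verts G - ?S) + card (neighbours G ?S) \<le> 2 * card sccs_verts"
    using cardF by linarith
  moreover have "?S \<subseteq> verts G"
    unfolding verts_G using cL(1) by auto
  ultimately show thesis
    by (intro that)
qed

lemma disjoint_union_of_stars_iff:
  "disjoint_union_of_stars G \<longleftrightarrow>
    (\<exists>S\<subseteq>verts G. card (verts G - S) + card (neighbours G S) = 2 * card sccs_verts)"
proof
  assume "disjoint_union_of_stars G"
  then obtain S where "S \<subseteq> verts G"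
      "card (verts G - S) + card (neighbours G S) \<le> 2 * card sccs_verts"
    by (rule disjoint_union_of_stars_total_le)
  with total_ge[of S]
  show "\<exists>S\<subseteq>verts G. card (verts G - S) + card (neighbours G S) = 2 * card sccs_verts"
    by (intro exI[of _ S] conjI order_antisym)
qed (elim exE conjE disjoint_union_of_stars_if_total_eq)

end

section \<open>Translation to \<open>\<gamma>\<close>\<close>

text \<open>
  Since \<open>|S| - |N(S)| = |V| - (|V - S| + |N(S)|)\<close>, the maximum \<open>\<delta>\<close> is \<open>|V|\<close> minus the least total.
\<close>

lemma (in fin_digraph) graph_delta_le_iff:
  "graph_delta G \<le> int (card (verts G)) - int k \<longleftrightarrow>
    (\<forall>S\<subseteq>verts G. k \<le> card (verts G - S) + card (neighbours G S))"
  and graph_delta_attained: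
  "\<exists>S\<subseteq>verts G. graph_delta G
    = int (card (verts G)) - int (card (verts G - S) + card (neighbours G S))"
proof -
  let ?D = "\<lambda>S. int (card S) - int (card (neighbours G S))"
  have D: "?D S = int (card (verts G)) - int (card (verts G - S) + card (neighbours G S))"
    if "S \<subseteq> verts G" for S
    using that card_mono[OF finite_verts that] card_Diff_subset[OF finite_subset[OF that finite_verts] that]
    by simp
  have eq: "{?D S | S. S \<subseteq> verts G} = ?D ` Pow (verts G)"
    by blast
  then have fin: "finite {?D S | S. S \<subseteq> verts G}" and ne: "{?D S | S. S \<subseteq> verts G} \<noteq> {}"
    by auto
  show "graph_delta G \<le> int (card (verts G)) - int k \<longleftrightarrow>
    (\<forall>S\<subseteq>verts G. k \<le> card (verts G - S) + card (neighbours G S))"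
  proof -
    have "?D S \<le> int (card (verts G)) - int k \<longleftrightarrow> k \<le> card (verts G - S) + card (neighbours G S)"
      if "S \<subseteq> verts G" for S
      unfolding D[OF that] by linarith
    then show ?thesis
      unfolding graph_delta_def Max_le_iff[OF fin ne] unfolding eq by auto
  qed
  show "\<exists>S\<subseteq>verts G. graph_delta G
    = int (card (verts G)) - int (card (verts G - S) + card (neighbours G S))"
  proof -
    have "graph_delta G \<in> ?D ` Pow (verts G)"
      using Max_in[OF fin ne] unfolding graph_delta_def eq .
    then obtain S where S: "S \<subseteq> verts G" "graph_delta G = ?D S"
      by (elim imageE PowD[elim_format])
    show ?thesis
      using S(1) S(2)[unfolded D[OF S(1)]] by (intro exI[of _ S] conjI)
  qed
qed

theorem corollary4p1:
  fixes H :: "('a, 'b) pre_digraph"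
  assumes "graph H"
    and "\<forall>v\<in>verts H. \<exists>u. v \<rightarrow>\<^bsub>H\<^esub> u"
  shows "graph_gamma H \<le> real (card (verts H)) - real (card (components H)) \<and>
         (graph_gamma H = real (card (verts H)) - real (card (components H))
            \<longleftrightarrow> disjoint_union_of_stars H)"
proof -
  interpret graph H
    by (rule assms(1))
  interpret no_isolated_graph H
    using assms(2) by unfold_locales blast
  let ?n = "card (verts H)"
  let ?k = "card sccs_verts"
  have le: "graph_delta H \<le> int ?n - int (2 * ?k)"
    by (simp only: graph_delta_le_iff total_ge simp_thms)
  have eq: "graph_delta H = int ?n - int (2 * ?k) \<longleftrightarrow> disjoint_union_of_stars H"
  proof
    assume "graph_delta H = int ?n - int (2 * ?k)"
    moreover obtain S where "S \<subseteq> verts H"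
        "graph_delta H = int ?n - int (card (verts H - S) + card (neighbours H S))"
      using graph_delta_attained by (elim exE conjE)
    ultimately show "disjoint_union_of_stars H"
      by (intro disjoint_union_of_stars_if_total_eq[of S]) linarith
  next
    assume "disjoint_union_of_stars H"
    then obtain S where "S \<subseteq> verts H" "card (verts H - S) + card (neighbours H S) = 2 * ?k"
      unfolding disjoint_union_of_stars_iff by (elim exE conjE)
    \<comment> \<open>A bound smaller by 1 would force every total to be at least \<open>2\<nu> + 1\<close>.\<close>
    then have "\<not> graph_delta H \<le> int ?n - int (Suc (2 * ?k))"
      unfolding graph_delta_le_iff by auto
    with le show "graph_delta H = int ?n - int (2 * ?k)"
      by linarith
  qed
  have gamma: "graph_gamma H = real ?n - real ?k + (graph_delta H - (int ?n - int (2 * ?k))) / 2"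
    by (simp add: graph_gamma_def field_simps)
  have "graph_gamma H \<le> real ?n - real ?k"
    using le unfolding gamma by simp
  moreover have "graph_gamma H = real ?n - real ?k \<longleftrightarrow> graph_delta H = int ?n - int (2 * ?k)"
    unfolding gamma by auto
  ultimately show ?thesis
    using eq by (simp only: card_components simp_thms)
qed

end
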